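(* Let $\phi\colon\mathbb{F}_2^{m+1}\to\mathbb{F}_2^{m-1}$ be a $4$-to-$1$ mapping such that $\{\phi^{-1}(a)\mid a\in\mathbb{F}_2^{m-1}\}$ is a partition of $\mathbb{F}_2^{m+1}$ into $2$-dimensional affine subspaces. Then there are exactly $2^{3\cdot2^{m-1}}$ functions $h\colon\mathbb{F}_2^{m+1}\to\mathbb{F}_2$ such that the function $f$ defined by $f(x,y)=x\cdot\phi(y)+h(y)$, $x\in\mathbb{F}_2^{m-1}$, $y\in\mathbb{F}_2^{m+1}$, is bent.
   Context: $m$ is a positive integer. "$\cdot$" is the standard dot product over $\mathbb{F}_2$. $\phi^{-1}(a)=\{y\in\mathbb{F}_2^{m+1}\mid\phi(y)=a\}$; $\phi$ is $4$-to-$1$ if $|\phi^{-1}(a)|=4$ for every $a\in\mathbb{F}_2^{m-1}$. For $f\colon\mathbb{F}_2^n\to\mathbb{F}_2$, $W_f(\omega)=\sum_{x\in\mathbb{F}_2^n}(-1)^{f(x)+\omega\cdot x}$. For $n$ even, $f$ is bent if $W_f(\omega)=\pm2^{n/2}$ for all $\omega\in\mathbb{F}_2^n$. $\mathbb{F}_2^{m-1}\times\mathbb{F}_2^{m+1}$ is identified with $\mathbb{F}_2^{2m}$. *)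

theory Defs
  imports
    "Jordan_Normal_Form.VS_Connect"
    "HOL-Library.Z2"
    "HOL-Library.Disjoint_Sets"
    "HOL-Library.FuncSet"
begin

text \<open>
  The field with two elements is the type \<^typ>\<open>bit\<close>, and its \<open>n\<close>-th Cartesian power is
  \<open>carrier_vec n\<close> at type \<^typ>\<open>bit vec\<close>.
\<close>

abbreviation F2 :: "nat \<Rightarrow> bit vec set" where
  "F2 n \<equiv> carrier_vec n"

text \<open>The sign \<open>(-1)^b\<close> for \<open>b\<close> in the field with two elements.\<close>

definition bit_sign :: "bit \<Rightarrow> int" where
  "bit_sign b = (if b = 0 then 1 else -1)"

definition walsh :: "nat \<Rightarrow> (bit vec \<Rightarrow> bit) \<Rightarrow> bit vec \<Rightarrow> int" where
  "walsh n f w = (\<Sum>x\<in>F2 n. bit_sign (f x + w \<bullet> x))"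

definition bent :: "nat \<Rightarrow> (bit vec \<Rightarrow> bit) \<Rightarrow> bool" where
  "bent n f \<longleftrightarrow> even n \<and>
     (\<forall>w\<in>F2 n. walsh n f w = 2 ^ (n div 2) \<or> walsh n f w = - (2 ^ (n div 2)))"

definition fibre :: "nat \<Rightarrow> (bit vec \<Rightarrow> bit vec) \<Rightarrow> bit vec \<Rightarrow> bit vec set" where
  "fibre n \<phi> a = {y \<in> F2 n. \<phi> y = a}"

text \<open>
  A translate of a \<open>d\<close>-dimensional linear subspace of the space of bit vectors of length \<open>n\<close>.
  In \<open>VectorSpace\<close>, a linear subspace regarded as a vector space of its own is the ambient space
  with its carrier replaced.
\<close>

definition affine_subspace :: "nat \<Rightarrow> nat \<Rightarrow> bit vec set \<Rightarrow> bool" where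
  "affine_subspace n d A \<longleftrightarrow>
     (\<exists>v W. v \<in> F2 n
        \<and> VectorSpace.subspace class_ring W (module_vec TYPE(bit) n)
        \<and> vectorspace.fin_dim class_ring ((module_vec TYPE(bit) n)\<lparr>carrier := W\<rparr>)
        \<and> vectorspace.dim class_ring ((module_vec TYPE(bit) n)\<lparr>carrier := W\<rparr>) = d
        \<and> A = (\<lambda>w. v + w) ` W)"

text \<open>
  The function \<open>(x, y) \<mapsto> x \<cdot> \<phi> y + h y\<close>, where \<open>x\<close> has length \<open>k\<close> and \<open>y\<close> has length \<open>l\<close>,
  as a function of the concatenation of \<open>x\<close> and \<open>y\<close>, a vector of length \<open>k + l\<close>.
\<close>

definition mm_fun ::
  "nat \<Rightarrow> nat \<Rightarrow> (bit vec \<Rightarrow> bit vec) \<Rightarrow> (bit vec \<Rightarrow> bit) \<Rightarrow> bit vec \<Rightarrow> bit" where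
  "mm_fun k l \<phi> h z = vec_first z k \<bullet> \<phi> (vec_last z l) + h (vec_last z l)"

end

theory Submission
  imports Defs
begin

text \<open>
  Summing first over \<open>x\<close>, orthogonality of characters collapses the Walsh coefficient at \<open>(a, b)\<close>
  to \<open>2 ^ (m - 1)\<close> times the sum of \<open>(-1) ^ (h y + b \<bullet> y)\<close> over the fibre of \<open>a\<close>. Four signs add up
  to \<open>2\<close> or \<open>-2\<close> iff their product is \<open>-1\<close>, and the terms \<open>b \<bullet> y\<close> cancel since the four points of an
  affine plane sum to zero. So bentness says exactly that \<open>h\<close> sums to \<open>1\<close> over every fibre: \<open>h\<close> is
  free except at one point of each of the \<open>2 ^ (m - 1)\<close> fibres.
\<close>

section \<open>Finiteness, cardinality and cancellation for bit vectors\<close>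

lemma UNIV_bit: "(UNIV :: bit set) = {0, 1}"
  by (auto intro: bit.exhaust)

text \<open>Encodes vectors as extensional functions on the index set, so that finiteness and
  cardinality of \<open>F2 n\<close> reduce to those of a function space.\<close>

lemma bij_betw_vec: "bij_betw (vec n) ({..<n} \<rightarrow>\<^sub>E UNIV) (carrier_vec n)"
  by (rule bij_betw_byWitness[where f' = "\<lambda>v. \<lambda>i\<in>{..<n}. v $ i"])
     (auto simp: PiE_def extensional_def fun_eq_iff)

lemma finite_F2: "finite (F2 n)"
  using bij_betw_finite[OF bij_betw_vec[of n, where 'a = bit]]
  by (simp add: finite_PiE UNIV_bit)

lemma card_F2: "card (F2 n) = 2 ^ n"
  using bij_betw_same_card[OF bij_betw_vec[of n, where 'a = bit]]
  by (simp add: card_PiE UNIV_bit numeral_2_eq_2)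

lemma add_left_cancel_vec:
  fixes v :: "'a :: cancel_semigroup_add vec"
  assumes v: "v \<in> carrier_vec n" and x: "x \<in> carrier_vec n" and y: "y \<in> carrier_vec n"
  shows "v + x = v + y \<longleftrightarrow> x = y"
proof
  assume *: "v + x = v + y"
  show "x = y"
  proof (rule eq_vecI)
    fix i assume i: "i < dim_vec y"
    have "(v + x) $ i = (v + y) $ i"
      using * by simp
    then show "x $ i = y $ i"
      using v x y i by simp
  qed (use x y in simp)
qed simp

section \<open>Signs, character sums and Walsh coefficients\<close>

lemma bit_sign_add: "bit_sign (a + b) = bit_sign a * bit_sign b"
  by (cases a; cases b) (simp_all add: bit_sign_def)

text \<open>Characteristic two: each vector is its own negative.\<close>

lemma bit_vec_add_eq_0_iff:
  assumes "u \<in> F2 n" and "v \<in> F2 n"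
  shows "u + v = 0\<^sub>v n \<longleftrightarrow> u = v"
proof
  assume *: "u + v = 0\<^sub>v n"
  show "u = v"
  proof (rule eq_vecI)
    fix i assume "i < dim_vec v"
    with * assms have "u $ i + v $ i = 0"
      by (metis carrier_vecD index_add_vec(1) index_zero_vec(1))
    then show "u $ i = v $ i"
      by (cases "u $ i"; cases "v $ i") simp_all
  qed (use assms in auto)
qed (use assms in \<open>auto intro!: eq_vecI\<close>)

text \<open>Translation by a unit vector at a coordinate where \<open>c\<close> is 1 flips every
  sign, so for nonzero \<open>c\<close> the sum equals its own negative.\<close>

lemma sum_bit_sign_scalar_prod:
  assumes c: "c \<in> F2 n"
  shows "(\<Sum>x\<in>F2 n. bit_sign (x \<bullet> c)) = (if c = 0\<^sub>v n then 2 ^ n else 0)"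
proof (cases "c = 0\<^sub>v n")
  case True
  then show ?thesis
    by (simp add: bit_sign_def card_F2)
next
  case False
  then obtain i where i: "i < n" "c $ i = 1"
    using c by (metis bit_not_zero_iff carrier_vecD dim_vec eq_vecI index_zero_vec)
  let ?t = "\<lambda>x. x + unit_vec n i"
  \<comment> \<open>Adding the same unit vector twice gives \<open>x\<close> back, so
    \<open>?t\<close> is an involution.\<close>
  have bij: "bij_betw ?t (F2 n) (F2 n)"
    by (rule bij_betw_byWitness[where f' = ?t]) (auto intro!: eq_vecI simp: add.assoc)
  have "(\<Sum>x\<in>F2 n. bit_sign (x \<bullet> c)) = (\<Sum>x\<in>F2 n. bit_sign (?t x \<bullet> c))"
    by (rule sum.reindex_bij_betw[OF bij, symmetric])
  also have "\<dots> = (\<Sum>x\<in>F2 n. - bit_sign (x \<bullet> c))"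
    using c i by (intro sum.cong) (simp_all add: add_scalar_prod_distrib[of _ n] bit_sign_add bit_sign_def)
  finally show ?thesis
    using False by (simp add: sum_negf)
qed

text \<open>Identifies pairs with concatenated vectors, which turns the Walsh sum into a double
  sum.\<close>

lemma bij_betw_append_vec:
  "bij_betw (\<lambda>(x, y). x @\<^sub>v y) (carrier_vec k \<times> carrier_vec l) (carrier_vec (k + l))"
  by (rule bij_betw_byWitness[where f' = "\<lambda>z. (vec_first z k, vec_last z l)"])
     (auto intro!: eq_vecI simp: vec_first_def vec_last_def)

lemma walsh_mm_fun:
  assumes \<phi>: "\<phi> \<in> F2 l \<rightarrow> F2 k" and a: "a \<in> F2 k" and b: "b \<in> F2 l"
  shows "walsh (k + l) (mm_fun k l \<phi> h) (a @\<^sub>v b) = 2 ^ k * (\<Sum>y\<in>fibre l \<phi> a. bit_sign (h y + b \<bullet> y))"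
proof -
  \<comment> \<open>Since \<open>x \<bullet> \<phi> y + a \<bullet> x = x \<bullet> (\<phi> y +
    a)\<close>, the exponent splits into a part free of \<open>x\<close> and a linear form in
    \<open>x\<close>.\<close>
  have eq: "bit_sign (mm_fun k l \<phi> h (x @\<^sub>v y) + (a @\<^sub>v b) \<bullet> (x @\<^sub>v y)) =
      bit_sign (h y + b \<bullet> y) * bit_sign (x \<bullet> (\<phi> y + a))" if x: "x \<in> F2 k" and y: "y \<in> F2 l" for x y
  proof -
    have "vec_first (x @\<^sub>v y) k = x" "vec_last (x @\<^sub>v y) l = y"
      using x y by (auto intro!: eq_vecI simp: vec_first_def vec_last_def)
    moreover have "\<phi> y \<in> F2 k"
      using \<phi> y by auto
    ultimately show ?thesis
      using a b x y
      by (simp add: mm_fun_def scalar_prod_append scalar_prod_add_distrib[of _ k]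
          comm_scalar_prod[of a k x] bit_sign_add del: add_bit_eq_xor)
  qed
  have "walsh (k + l) (mm_fun k l \<phi> h) (a @\<^sub>v b) =
      (\<Sum>(x, y)\<in>F2 k \<times> F2 l. bit_sign (mm_fun k l \<phi> h (x @\<^sub>v y) + (a @\<^sub>v b) \<bullet> (x @\<^sub>v y)))"
    unfolding walsh_def sum.reindex_bij_betw[OF bij_betw_append_vec, symmetric]
    by (simp add: case_prod_unfold)
  also have "\<dots> = (\<Sum>(x, y)\<in>F2 k \<times> F2 l. bit_sign (h y + b \<bullet> y) * bit_sign (x \<bullet> (\<phi> y + a)))"
    by (rule sum.cong) (auto simp: eq simp del: add_bit_eq_xor)
  also have "\<dots> = (\<Sum>y\<in>F2 l. bit_sign (h y + b \<bullet> y) * (\<Sum>x\<in>F2 k. bit_sign (x \<bullet> (\<phi> y + a))))"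
    by (simp add: sum.cartesian_product[symmetric] sum_distrib_left sum.swap[of _ "F2 k"])
  \<comment> \<open>The inner character sum vanishes unless \<open>\<phi> y + a\<close> is zero, so
    only the fibre of \<open>a\<close> survives.\<close>
  also have "\<dots> = (\<Sum>y\<in>F2 l. if \<phi> y = a then 2 ^ k * bit_sign (h y + b \<bullet> y) else 0)"
  proof (rule sum.cong)
    fix y assume "y \<in> F2 l"
    with \<phi> have "\<phi> y \<in> F2 k" by auto
    then show "bit_sign (h y + b \<bullet> y) * (\<Sum>x\<in>F2 k. bit_sign (x \<bullet> (\<phi> y + a))) =
        (if \<phi> y = a then 2 ^ k * bit_sign (h y + b \<bullet> y) else 0)"
      using a by (simp add: sum_bit_sign_scalar_prod bit_vec_add_eq_0_iff)
  qed simp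
  also have "\<dots> = (\<Sum>y\<in>fibre l \<phi> a. 2 ^ k * bit_sign (h y + b \<bullet> y))"
    unfolding fibre_def by (rule sum.inter_filter[symmetric]) (rule finite_F2)
  finally show ?thesis
    by (simp add: sum_distrib_left)
qed

section \<open>Four-point fibres and the bentness criterion\<close>

lemma sum_bit_sign_card_4:
  assumes "card A = 4"
  shows "(\<Sum>y\<in>A. bit_sign (g y)) = 2 \<or> (\<Sum>y\<in>A. bit_sign (g y)) = -2 \<longleftrightarrow> (\<Sum>y\<in>A. g y) = 1"
proof -
  from assms obtain p q r s where "A = {p, q, r, s}" "distinct [p, q, r, s]"
    by (auto simp: card_Suc_eq eval_nat_numeral)
  \<comment> \<open>Sixteen cases: the signs sum to 2 or -2 exactly when one or three of the four
    bits are 1; otherwise they sum to 4, 0 or -4.\<close>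
  then show ?thesis
    by (cases "g p"; cases "g q"; cases "g r"; cases "g s") (simp_all add: bit_sign_def)
qed

text \<open>Having four elements, the direction space \<open>W\<close> must be
  \<open>{0, s, t, s + t}\<close>. In the sum over \<open>v + W\<close> the vector \<open>v\<close>
  then occurs four times and \<open>s\<close> and \<open>t\<close> twice each, so everything
  cancels.\<close>

lemma sum_scalar_prod_affine_subspace:
  assumes A: "affine_subspace n d A" and card: "card A = 4" and b: "b \<in> F2 n"
  shows "(\<Sum>y\<in>A. b \<bullet> y) = 0"
proof -
  from A obtain v W where v: "v \<in> F2 n"
    and sub: "VectorSpace.subspace class_ring W (module_vec TYPE(bit) n)"
    and A_eq: "A = (\<lambda>w. v + w) ` W"
    unfolding affine_subspace_def by blast
  have "submodule class_ring W (module_vec TYPE(bit) n)"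
    using sub by (simp add: subspace_def)
  note W = this[THEN submodule.subset] this[THEN submodule.m_closed] this[THEN submodule.zero_closed]
  have WF: "W \<subseteq> F2 n" and add: "\<And>u w. u \<in> W \<Longrightarrow> w \<in> W \<Longrightarrow> u + w \<in> W" and zero: "0\<^sub>v n \<in> W"
    using W by (simp_all add: module_vec_simps)
  have inj: "inj_on (\<lambda>w. v + w) W"
    using v WF by (auto intro!: inj_onI simp: subset_iff add_left_cancel_vec[of v n])
  have cW: "card W = 4"
    using card card_image[OF inj] A_eq by simp
  then have fW: "finite W"
    by (simp add: card_ge_0_finite)
  have "card (W - {0\<^sub>v n}) = 3"
    using cW zero by simp
  then obtain s t r where *: "W - {0\<^sub>v n} = {s, t, r}" "s \<noteq> t" "t \<noteq> r" "s \<noteq> r"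
    by (auto simp: card_Suc_eq eval_nat_numeral)
  then have mem: "s \<in> W" "t \<in> W" "s \<noteq> 0\<^sub>v n" "t \<noteq> 0\<^sub>v n"
    by auto
  then have st: "s \<in> F2 n" "t \<in> F2 n"
    using WF by auto
  \<comment> \<open>By closure \<open>s + t\<close> lies in \<open>W\<close>; ruling out 0,
    \<open>s\<close> and \<open>t\<close> leaves only \<open>r\<close>.\<close>
  have "s + t \<noteq> 0\<^sub>v n"
    using st \<open>s \<noteq> t\<close> by (simp add: bit_vec_add_eq_0_iff)
  moreover have "s + t \<noteq> t" "s + t \<noteq> s"
    using mem st add_left_cancel_vec[of t n s "0\<^sub>v n"] add_left_cancel_vec[of s n t "0\<^sub>v n"]
    by (auto simp: comm_add_vec[of s n t])
  ultimately have "r = s + t"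
    using add[OF mem(1,2)] *(1) by auto
  then have W_eq: "W = {0\<^sub>v n, s, t, s + t}" and dist: "distinct [0\<^sub>v n, s, t, s + t]"
    using * zero mem by auto
  have "(\<Sum>y\<in>A. b \<bullet> y) = (\<Sum>w\<in>W. b \<bullet> (v + w))"
    unfolding A_eq by (simp add: sum.reindex[OF inj])
  also have "\<dots> = 0"
    using dist b v st unfolding W_eq
    by (cases "b \<bullet> v"; cases "b \<bullet> s"; cases "b \<bullet> t") (simp_all add: scalar_prod_add_distrib[of _ n])
  finally show ?thesis .
qed

text \<open>The terms \<open>b \<bullet> y\<close> cancel over a fibre, so all Walsh coefficients
  with first component \<open>a\<close> share a single parity condition.\<close>

lemma bent_mm_fun_iff:
  assumes \<phi>: "\<phi> \<in> F2 (m + 1) \<rightarrow> F2 (m - 1)" and m: "m \<ge> 1"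
    and card: "\<forall>a\<in>F2 (m - 1). card (fibre (m + 1) \<phi> a) = 4"
    and aff: "\<forall>a\<in>F2 (m - 1). affine_subspace (m + 1) d (fibre (m + 1) \<phi> a)"
  shows "bent (2 * m) (mm_fun (m - 1) (m + 1) \<phi> h) \<longleftrightarrow>
    (\<forall>a\<in>F2 (m - 1). (\<Sum>y\<in>fibre (m + 1) \<phi> a. h y) = 1)"
proof -
  let ?f = "mm_fun (m - 1) (m + 1) \<phi> h"
  have dim: "2 * m = (m - 1) + (m + 1)"
    using m by simp
  \<comment> \<open>Dividing the bent value \<open>2 ^ m\<close> by the factor
    \<open>2 ^ (m - 1)\<close> of the Walsh coefficient leaves 2, the required absolute value of a
    sum of four signs.\<close>
  have half: "(2::int) ^ m = 2 ^ (m - 1) * 2"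
    using m by (metis power_minus_mult less_eq_Suc_le One_nat_def)
  have point: "walsh (2 * m) ?f (a @\<^sub>v b) = 2 ^ m \<or> walsh (2 * m) ?f (a @\<^sub>v b) = - (2 ^ m) \<longleftrightarrow>
      (\<Sum>y\<in>fibre (m + 1) \<phi> a. h y) = 1" if a: "a \<in> F2 (m - 1)" and b: "b \<in> F2 (m + 1)" for a b
  proof -
    let ?S = "\<Sum>y\<in>fibre (m + 1) \<phi> a. bit_sign (h y + b \<bullet> y)"
    have "walsh (2 * m) ?f (a @\<^sub>v b) = 2 ^ (m - 1) * ?S"
      unfolding dim by (rule walsh_mm_fun[OF \<phi> a b])
    then have "walsh (2 * m) ?f (a @\<^sub>v b) = 2 ^ m \<or> walsh (2 * m) ?f (a @\<^sub>v b) = - (2 ^ m) \<longleftrightarrow>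
        ?S = 2 \<or> ?S = -2"
      unfolding half by (simp flip: mult_minus_right)
    also have "\<dots> \<longleftrightarrow> (\<Sum>y\<in>fibre (m + 1) \<phi> a. h y + b \<bullet> y) = 1"
      using card a by (intro sum_bit_sign_card_4) simp
    finally show ?thesis
      using sum_scalar_prod_affine_subspace[of "m + 1" d "fibre (m + 1) \<phi> a" b] aff card a b
      by (simp add: sum.distrib del: add_bit_eq_xor)
  qed
  have "F2 (2 * m) = (\<lambda>(x, y). x @\<^sub>v y) ` (F2 (m - 1) \<times> F2 (m + 1))"
    unfolding dim using bij_betw_append_vec by (metis bij_betw_imp_surj_on)
  then have "bent (2 * m) ?f \<longleftrightarrow> (\<forall>a\<in>F2 (m - 1). \<forall>b\<in>F2 (m + 1).
      walsh (2 * m) ?f (a @\<^sub>v b) = 2 ^ m \<or> walsh (2 * m) ?f (a @\<^sub>v b) = - (2 ^ m))"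
    by (auto simp: bent_def)
  \<comment> \<open>The condition does not depend on \<open>b\<close>; the zero vector supplies one
    \<open>b\<close> for the forward direction.\<close>
  also have "\<dots> \<longleftrightarrow> (\<forall>a\<in>F2 (m - 1). (\<Sum>y\<in>fibre (m + 1) \<phi> a. h y) = 1)"
    using point by (metis zero_carrier_vec)
  finally show ?thesis .
qed

section \<open>Counting functions with prescribed block sums, and the resulting count of bent
  functions\<close>

lemma card_prescribed_block_sums:
  fixes c :: "'a set \<Rightarrow> bit"
  assumes P: "partition_on S P" and S: "finite S"
  shows "card {h \<in> S \<rightarrow>\<^sub>E (UNIV :: bit set). \<forall>A\<in>P. (\<Sum>y\<in>A. h y) = c A} = 2 ^ (card S - card P)"
proof -
  have sub: "A \<subseteq> S" "finite A" if "A \<in> P" for A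
    using that P S by (auto simp: partition_on_def intro: finite_subset)
  have disj: "A = B" if "A \<in> P" "B \<in> P" "x \<in> A" "x \<in> B" for A B x
    using that P by (auto simp: partition_on_def disjoint_def)
  \<comment> \<open>One representative \<open>r A\<close> per block: its value will be forced by the
    others, while all values on \<open>S - R\<close> stay free.\<close>
  obtain r where r: "r A \<in> A" if "A \<in> P" for A
    using P unfolding partition_on_def by (metis ex_in_conv)
  have inj: "inj_on r P"
    using r disj by (metis inj_onI)
  define R where "R = r ` P"
  have RS: "R \<subseteq> S"
    using r sub by (auto simp: R_def)
  have Rcap: "x = r A" if "x \<in> R" "x \<in> A" "A \<in> P" for x A
    using that r disj unfolding R_def by (metis imageE)
  define block where "block y = (THE A. A \<in> P \<and> y \<in> A)" for y
  have block: "block y = A" if "A \<in> P" "y \<in> A" for y A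
    unfolding block_def using that disj by (intro the_equality) auto
  \<comment> \<open>The inverse of restriction to \<open>S - R\<close>: at a representative, solve
    the sum condition of its block for the missing value. Outside \<open>S\<close> the value is
    \<open>undefined\<close>, as extensionality demands.\<close>
  define ext where "ext g = (\<lambda>y\<in>S. if y \<in> R then c (block y) - (\<Sum>z\<in>block y - {y}. g z) else g y)"
    for g :: "'a \<Rightarrow> bit"
  have split: "(\<Sum>y\<in>A. h y) = h (r A) + (\<Sum>y\<in>A - {r A}. h y)" if "A \<in> P" for A and h :: "'a \<Rightarrow> bit"
    using r sub that by (intro sum.remove)
  have ext_r: "ext g (r A) = c A - (\<Sum>z\<in>A - {r A}. g z)" if "A \<in> P" for g A
    using that r[OF that] RS block[of A "r A"] by (auto simp: ext_def R_def)
  have ext_other: "ext g y = g y" if "y \<in> S - R" for g y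
    using that by (simp add: ext_def)
  \<comment> \<open>A block meets \<open>R\<close> only in its own representative, so each sum
    condition has exactly one unknown and the conditions are independent.\<close>
  have diff: "A - {r A} \<subseteq> S - R" if "A \<in> P" for A
    using that sub Rcap by blast
  let ?H = "{h \<in> S \<rightarrow>\<^sub>E (UNIV :: bit set). \<forall>A\<in>P. (\<Sum>y\<in>A. h y) = c A}"
  have "bij_betw (\<lambda>h. restrict h (S - R)) ?H ((S - R) \<rightarrow>\<^sub>E UNIV)"
  proof (rule bij_betw_byWitness[where f' = ext])
    show "\<forall>h\<in>?H. ext (restrict h (S - R)) = h"
    proof (intro ballI ext)
      fix h y assume h: "h \<in> ?H"
      consider "y \<notin> S" | "y \<in> S - R" | A where "A \<in> P" "y = r A"
        by (auto simp: R_def)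
      then show "ext (restrict h (S - R)) y = h y"
      proof cases
        case 1
        then show ?thesis using h by (auto simp: ext_def PiE_def extensional_def)
      next
        case 2
        then show ?thesis by (simp add: ext_other)
      next
        case 3
        have "(\<Sum>z\<in>A - {r A}. restrict h (S - R) z) = (\<Sum>z\<in>A - {r A}. h z)"
          using diff[OF 3(1)] by (intro sum.cong) auto
        then have "ext (restrict h (S - R)) y = c A - (\<Sum>z\<in>A - {r A}. h z)"
          using ext_r[OF 3(1)] 3(2) by simp
        also have "\<dots> = h y"
          using h 3 split[OF 3(1), of h] by (metis (mono_tags, lifting) add_diff_cancel_right' mem_Collect_eq)
        finally show ?thesis .
      qed
    qed
    show "\<forall>g\<in>(S - R) \<rightarrow>\<^sub>E UNIV. restrict (ext g) (S - R) = g"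
      by (auto simp: fun_eq_iff ext_other PiE_def extensional_def restrict_def)
    show "(\<lambda>h. restrict h (S - R)) ` ?H \<subseteq> (S - R) \<rightarrow>\<^sub>E UNIV"
      by auto
    show "ext ` ((S - R) \<rightarrow>\<^sub>E UNIV) \<subseteq> ?H"
    proof (rule image_subsetI)
      fix g
      have "(\<Sum>y\<in>A. ext g y) = c A" if A: "A \<in> P" for A
      proof -
        have "(\<Sum>y\<in>A - {r A}. ext g y) = (\<Sum>y\<in>A - {r A}. g y)"
          using diff[OF A] by (intro sum.cong) (auto simp: ext_other)
        then show ?thesis
          by (simp only: split[OF A] ext_r[OF A] diff_add_cancel)
      qed
      then show "ext g \<in> ?H"
        by (simp add: ext_def)
    qed
  qed
  then have "card ?H = card ((S - R) \<rightarrow>\<^sub>E (UNIV :: bit set))"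
    by (rule bij_betw_same_card)
  also have "\<dots> = 2 ^ card (S - R)"
    using S by (simp add: card_PiE UNIV_bit numeral_2_eq_2)
  also have "card (S - R) = card S - card P"
    using RS S card_image[OF inj] by (simp add: card_Diff_subset finite_subset R_def)
  finally show ?thesis .
qed

text \<open>Extensionality fixes the values of \<open>h\<close> off \<open>F2 (m + 1)\<close>, so
  each function on that space is counted exactly once.\<close>

theorem corollary3p6:
  fixes m :: nat and \<phi> :: "bit vec \<Rightarrow> bit vec"
  assumes "m \<ge> 1"
    and "\<phi> \<in> F2 (m + 1) \<rightarrow> F2 (m - 1)"
    and "\<forall>a \<in> F2 (m - 1). card (fibre (m + 1) \<phi> a) = 4"
    and "partition_on (F2 (m + 1)) (fibre (m + 1) \<phi> ` F2 (m - 1))"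
    and "\<forall>a \<in> F2 (m - 1). affine_subspace (m + 1) 2 (fibre (m + 1) \<phi> a)"
  shows "card {h \<in> F2 (m + 1) \<rightarrow>\<^sub>E (UNIV :: bit set).
                 bent (2 * m) (mm_fun (m - 1) (m + 1) \<phi> h)} = 2 ^ (3 * 2 ^ (m - 1))"
proof -
  let ?P = "fibre (m + 1) \<phi> ` F2 (m - 1)"
  \<comment> \<open>Fibres are nonempty, so distinct \<open>a\<close> yield distinct blocks and the
    number of blocks is that of the points \<open>a\<close>.\<close>
  have "inj_on (fibre (m + 1) \<phi>) (F2 (m - 1))"
  proof (rule inj_onI)
    fix a b assume a: "a \<in> F2 (m - 1)" and eq: "fibre (m + 1) \<phi> a = fibre (m + 1) \<phi> b"
    have "fibre (m + 1) \<phi> a \<noteq> {}"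
      using assms(3) a by force
    with eq show "a = b"
      by (auto simp: fibre_def)
  qed
  then have "card ?P = 2 ^ (m - 1)"
    by (simp add: card_image card_F2)
  \<comment> \<open>Four points per block; giving up one in each leaves three free values per
    block.\<close>
  moreover have "card (F2 (m + 1)) = 4 * 2 ^ (m - 1)"
    using assms(1) by (cases m) (simp_all add: card_F2)
  ultimately have exponent: "card (F2 (m + 1)) - card ?P = 3 * 2 ^ (m - 1)"
    by simp
  have "{h \<in> F2 (m + 1) \<rightarrow>\<^sub>E (UNIV :: bit set). bent (2 * m) (mm_fun (m - 1) (m + 1) \<phi> h)} =
      {h \<in> F2 (m + 1) \<rightarrow>\<^sub>E UNIV. \<forall>A\<in>?P. (\<Sum>y\<in>A. h y) = 1}"
    using bent_mm_fun_iff[OF assms(2,1,3,5)] by simp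
  then show ?thesis
    using card_prescribed_block_sums[OF assms(4) finite_F2, of "\<lambda>_. 1"] exponent by simp
qed

end
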